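(* Let $r\in\mathbb{N}$, $n\in\mathbb{Z}_+$ and $x\in\mathbb{Z}_p$. Define the numbers $G_{k,w,q}^{(r)}(x)$ ($k\in\mathbb{Z}_+$) by $$2^r t^r\sum_{m=0}^{\infty}\binom{m+r-1}{m}(-1)^m w^m e^{t[m+x]_q}=\sum_{k=0}^{\infty}G_{k,w,q}^{(r)}(x)\frac{t^k}{k!},$$ and let $E_{n,w,q}^{(r)}(x)=\int_{\mathbb{Z}_p^r} w^{x_1+\cdots+x_r}[x+x_1+\cdots+x_r]_q^n\,d\mu_{-1}(x_1)\cdots d\mu_{-1}(x_r)$. Then $$\frac{G_{n+r,w,q}^{(r)}(x)}{r!\binom{n+r}{r}}=\int_{\mathbb{Z}_p^r} w^{x_1+\cdots+x_r}[x+x_1+\cdots+x_r]_q^n\,d\mu_{-1}(x_1)\cdots d\mu_{-1}(x_r)=E_{n,w,q}^{(r)}(x),$$ and $G_{0,w,q}^{(r)}(x)=G_{1,w,q}^{(r)}(x)=\cdots=G_{r-1,w,q}^{(r)}(x)=0$.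
   Context: Let $p$ be a fixed odd prime, $\mathbb{Z}_p$ the ring of $p$-adic integers, $\mathbb{C}_p$ the completion of the algebraic closure of $\mathbb{Q}_p$, and $\mathbb{Z}_+=\mathbb{N}\cup\{0\}$. Let $q,w\in\mathbb{C}_p$ with $|1-q|_p<1$ and $|1-w|_p<1$. For $x\in\mathbb{Z}_p$ put $[x]_q=\frac{1-q^x}{1-q}$. For a uniformly differentiable function $f:\mathbb{Z}_p\to\mathbb{C}_p$, the fermionic $p$-adic integral is $\int_{\mathbb{Z}_p}f(x)\,d\mu_{-1}(x)=\lim_{N\to\infty}\sum_{x=0}^{p^N-1}f(x)(-1)^x$, and $\int_{\mathbb{Z}_p^r}$ denotes the $r$-fold iterated fermionic integral.
   Formalization: The series over m defining G diverges p-adically since |w|=1; it is read coefficientwise in t as the value at T=w of the rational function of T with that power series expansion (so that Σ binom(m+r-1,m)(-c)^m w^m=(1+cw)^{-r}); and [x]_q means x when q=1. *)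

theory Defs
  imports "HOL-Analysis.Analysis" "HOL-Computational_Algebra.Computational_Algebra"
begin

text \<open>
  The field of \<open>p\<close>-adic complex numbers is given by its defining properties, which determine it up to
  isometric isomorphism: it is a complete valued field in which the elements algebraic over
  \<open>\<rat>\<^sub>p\<close> form a dense algebraic closure of \<open>\<rat>\<^sub>p\<close>, where \<open>\<rat>\<^sub>p\<close> is the completion of
  \<open>\<rat>\<close>, i.e. its closure in the complete field.  A multiplicative ultrametric absolute value
  taking the value \<open>1/p\<close> at \<open>p\<close> restricts on \<open>\<rat>\<close> to the normalised \<open>p\<close>-adic one.
\<close>

definition padic_rats :: "'c::{field_char_0, complete_space} set" where
  "padic_rats = closure \<rat>"

definition padic_algebraic :: "'c::{field_char_0, complete_space} set" where
  "padic_algebraic =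
     {z. \<exists>P. P \<noteq> 0 \<and> (\<forall>i. coeff P i \<in> padic_rats) \<and> poly P z = 0}"

locale padic_complex =
  fixes p :: nat and vabs :: "'c::{field_char_0, complete_space} \<Rightarrow> real"
  assumes prime_p: "prime p"
    and dist_vabs: "dist x y = vabs (x - y)"
    and vabs_mult: "vabs (x * y) = vabs x * vabs y"
    and vabs_ultra: "vabs (x + y) \<le> max (vabs x) (vabs y)"
    and vabs_p: "vabs (of_nat p) = 1 / real p"
    and algebraic_closed:
      "(\<forall>i. coeff (P :: 'c poly) i \<in> padic_algebraic) \<Longrightarrow> degree P > 0
         \<Longrightarrow> \<exists>z\<in>padic_algebraic. poly P z = 0"
    and algebraic_dense: "closure (padic_algebraic :: 'c set) = UNIV"

definition padic_ints :: "('c::{field_char_0, complete_space} \<Rightarrow> real) \<Rightarrow> 'c set" where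
  "padic_ints vabs = {x \<in> padic_rats. vabs x \<le> 1}"

text \<open>
  For \<open>x \<in> \<int>\<^sub>p\<close> and \<open>|1 - a| < 1\<close>, the power \<open>a\<^sup>x\<close> is the continuous extension of
  \<open>n \<mapsto> a\<^sup>n\<close> from the dense subset \<open>\<nat>\<close> to \<open>\<int>\<^sub>p\<close>.
\<close>

definition padic_pow :: "'c::{field_char_0, complete_space} \<Rightarrow> 'c \<Rightarrow> 'c" where
  "padic_pow a x = Lim (filtercomap of_nat (nhds x)) (\<lambda>n::nat. a ^ n)"

text \<open>The value at \<open>q = 1\<close> is the usual one, \<open>lim\<^bsub>q \<rightarrow> 1\<^esub> [x]\<^sub>q = x\<close>.\<close>

definition qnum :: "'c::{field_char_0, complete_space} \<Rightarrow> 'c \<Rightarrow> 'c" where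
  "qnum q x = (if q = 1 then x else (1 - padic_pow q x) / (1 - q))"

definition fermionic_integral ::
    "nat \<Rightarrow> ('c::{field_char_0, complete_space} \<Rightarrow> 'c) \<Rightarrow> 'c" where
  "fermionic_integral p f = lim (\<lambda>N. \<Sum>x<p ^ N. f (of_nat x) * (-1) ^ x)"

primrec fermionic_integral_iter ::
    "nat \<Rightarrow> nat \<Rightarrow> ('c::{field_char_0, complete_space} list \<Rightarrow> 'c) \<Rightarrow> 'c" where
  "fermionic_integral_iter p 0 f = f []"
| "fermionic_integral_iter p (Suc r) f =
     fermionic_integral p (\<lambda>y. fermionic_integral_iter p r (\<lambda>ys. f (y # ys)))"

definition q_euler ::
    "nat \<Rightarrow> nat \<Rightarrow> 'c::{field_char_0, complete_space} \<Rightarrow> 'c \<Rightarrow> 'c \<Rightarrow> nat \<Rightarrow> 'c" where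
  "q_euler p r w q x n =
     fermionic_integral_iter p r (\<lambda>xs. padic_pow w (sum_list xs) * qnum q (x + sum_list xs) ^ n)"

text \<open>
  For \<open>|1 - w| < 1\<close> the terms of \<open>\<Sum>\<^sub>m (m+r-1 choose m) (-1)\<^sup>m w\<^sup>m [m+x]\<^sub>q\<^sup>k\<close> do not tend
  to \<open>0\<close> \<open>p\<close>-adically.  Such a series \<open>\<Sum>\<^sub>m a\<^sub>m w\<^sup>m\<close> is summed as it is in formal computations,
  by \<open>\<Sum>\<^sub>m (m+r-1 choose m) (-c)\<^sup>m w\<^sup>m = (1 + c w)\<^sup>-\<^sup>r\<close>: the power series
  \<open>\<Sum>\<^sub>m a\<^sub>m T\<^sup>m\<close> is the expansion of a rational function of \<open>T\<close>, which is evaluated at \<open>T = w\<close>.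
\<close>

definition has_rational_sum :: "(nat \<Rightarrow> 'a::field) \<Rightarrow> 'a \<Rightarrow> 'a \<Rightarrow> bool" where
  "has_rational_sum a z s \<longleftrightarrow>
     (\<exists>P Q. poly Q z \<noteq> 0 \<and> fps_of_poly Q * Abs_fps a = fps_of_poly P \<and> s = poly P z / poly Q z)"

definition rational_sum :: "(nat \<Rightarrow> 'a::field) \<Rightarrow> 'a \<Rightarrow> 'a" where
  "rational_sum a z = (THE s. has_rational_sum a z s)"

lemma has_rational_sum_unique:
  assumes "has_rational_sum a z s" and "has_rational_sum a z s'"
  shows "s = s'"
proof -
  obtain P Q where PQ: "poly Q z \<noteq> 0" "fps_of_poly Q * Abs_fps a = fps_of_poly P"
      "s = poly P z / poly Q z"
    using assms(1) unfolding has_rational_sum_def by blast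
  obtain P' Q' where PQ': "poly Q' z \<noteq> 0" "fps_of_poly Q' * Abs_fps a = fps_of_poly P'"
      "s' = poly P' z / poly Q' z"
    using assms(2) unfolding has_rational_sum_def by blast
  have "fps_of_poly (P * Q') = fps_of_poly (P' * Q)"
    unfolding fps_of_poly_mult PQ(2)[symmetric] PQ'(2)[symmetric] by (simp add: mult_ac)
  then have "P * Q' = P' * Q"
    by (simp only: fps_of_poly_eq_iff)
  then have "poly P z * poly Q' z = poly P' z * poly Q z"
    by (metis poly_mult)
  then show ?thesis
    using PQ PQ' by (simp add: frac_eq_eq)
qed

lemma rational_sum_eqI: "has_rational_sum a z s \<Longrightarrow> rational_sum a z = s"
  unfolding rational_sum_def using has_rational_sum_unique by blast

lemma has_rational_sum_binomial:
  fixes c z :: "'a::field"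
  assumes "r > 0" and "1 + c * z \<noteq> 0"
  shows "has_rational_sum (\<lambda>m. of_nat ((m + r - 1) choose m) * (- c) ^ m) z (1 / (1 + c * z) ^ r)"
proof -
  define A where "A r = Abs_fps (\<lambda>m. of_nat ((m + r - 1) choose m) * (- c) ^ m)" for r
  have A1: "fps_of_poly [:1, c:] * A (Suc 0) = 1"
    by (rule fps_ext) (auto simp: fps_of_poly_pCons A_def algebra_simps fps_eq_iff
          fps_mult_fps_X_commute[symmetric] power_eq_if split: nat.splits)
  have AS: "fps_of_poly [:1, c:] * A (Suc (Suc k)) = A (Suc k)" for k
  proof (rule fps_ext)
    fix m
    show "(fps_of_poly [:1, c:] * A (Suc (Suc k))) $ m = A (Suc k) $ m"
      by (cases m) (auto simp: fps_of_poly_pCons A_def algebra_simps)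
  qed
  have pow: "fps_of_poly [:1, c:] ^ Suc k * A (Suc k) = 1" for k
  proof (induction k)
    case 0
    then show ?case using A1 by simp
  next
    case (Suc k)
    then show ?case
      using AS[of k] by (metis mult.assoc power_Suc2)
  qed
  obtain k where k: "r = Suc k" using assms(1) by (cases r) auto
  have "fps_of_poly ([:1, c:] ^ r) * A r = fps_of_poly 1"
    using pow[of k] by (simp add: k fps_of_poly_power del: power_Suc)
  moreover have "poly ([:1, c:] ^ r) z = (1 + c * z) ^ r"
    by (simp add: poly_power mult.commute)
  ultimately show ?thesis
    unfolding has_rational_sum_def A_def using assms(2)
    by (intro exI[of _ 1] exI[of _ "[:1, c:] ^ r"]) simp
qed

text \<open>\<open>\<Sum>\<^sub>m F\<^sub>m(t) z\<^sup>m\<close> for formal power series \<open>F\<^sub>m\<close> in \<open>t\<close>, summed coefficientwise in \<open>t\<close>.\<close>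

definition rational_fps_sum :: "(nat \<Rightarrow> 'a::field fps) \<Rightarrow> 'a \<Rightarrow> 'a fps" where
  "rational_fps_sum F z = Abs_fps (\<lambda>k. rational_sum (\<lambda>m. fps_nth (F m) k) z)"

definition q_genocchi_gf ::
    "nat \<Rightarrow> 'c::{field_char_0, complete_space} \<Rightarrow> 'c \<Rightarrow> 'c \<Rightarrow> 'c fps" where
  "q_genocchi_gf r w q x =
     fps_const (2 ^ r) * fps_X ^ r *
     rational_fps_sum
       (\<lambda>m. fps_const (of_nat ((m + r - 1) choose m) * (-1) ^ m) * fps_exp (qnum q (of_nat m + x))) w"

definition q_genocchi ::
    "nat \<Rightarrow> 'c::{field_char_0, complete_space} \<Rightarrow> 'c \<Rightarrow> 'c \<Rightarrow> nat \<Rightarrow> 'c" where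
  "q_genocchi r w q x k = fact k * fps_nth (q_genocchi_gf r w q x) k"

lemma q_genocchi_gf_eq: "q_genocchi_gf r w q x = Abs_fps (\<lambda>k. q_genocchi r w q x k / fact k)"
  by (simp add: fps_eq_iff q_genocchi_def)

end

theory Submission
  imports Defs "HOL-Number_Theory.Cong"
begin

text \<open>
  Let \<open>P h m = h m + w h (m + 1)\<close>.  If \<open>f = P h\<close>, then the alternating sums of \<open>w\<^sup>m f m\<close>
  telescope, so the fermionic integral of \<open>w\<^sup>y f (s + y)\<close> is \<open>2 h s\<close>; on the other side, the formal sum
  of \<open>(m+r choose m) (-w)\<^sup>m f m\<close> equals that of \<open>(m+r-1 choose m) (-w)\<^sup>m h m\<close>, by Pascal's rule.
  Hence \<open>f = P\<^sup>r h\<close> has \<open>r\<close>-fold integral \<open>2\<^sup>r h 0\<close> and formal sum \<open>h 0\<close>.  On the exponential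
  polynomials spanned by \<open>c\<^sup>m (m choose j)\<close> with \<open>|1 - c| < 1\<close>, the operator \<open>P\<close> is onto because
  \<open>1 + w c \<noteq> 0\<close> for odd \<open>p\<close>, and \<open>m \<mapsto> [x + m]\<^sub>q\<^sup>n\<close> is such a function, both for \<open>q = 1\<close> and
  for \<open>q \<noteq> 1\<close>.
\<close>

section \<open>Rational summation\<close>

lemma has_rational_sum_add:
  assumes "has_rational_sum a z s" and "has_rational_sum b z t"
  shows "has_rational_sum (\<lambda>m. a m + b m) z (s + t)"
proof -
  obtain P Q where PQ: "poly Q z \<noteq> 0" "fps_of_poly Q * Abs_fps a = fps_of_poly P"
      "s = poly P z / poly Q z"
    using assms(1) unfolding has_rational_sum_def by blast
  obtain P' Q' where PQ': "poly Q' z \<noteq> 0" "fps_of_poly Q' * Abs_fps b = fps_of_poly P'"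
      "t = poly P' z / poly Q' z"
    using assms(2) unfolding has_rational_sum_def by blast
  have "Abs_fps (\<lambda>m. a m + b m) = Abs_fps a + Abs_fps b"
    by (simp add: fps_eq_iff)
  then have "fps_of_poly (Q * Q') * Abs_fps (\<lambda>m. a m + b m) = fps_of_poly (P * Q' + P' * Q)"
    by (simp add: fps_of_poly_mult fps_of_poly_add PQ(2)[symmetric] PQ'(2)[symmetric] algebra_simps)
  then show ?thesis
    unfolding has_rational_sum_def using PQ(1,3) PQ'(1,3)
    by (intro exI[of _ "P * Q' + P' * Q"] exI[of _ "Q * Q'"]) (simp add: add_frac_eq)
qed

lemma has_rational_sum_cmult:
  assumes "has_rational_sum a z s"
  shows "has_rational_sum (\<lambda>m. c * a m) z (c * s)"
proof -
  obtain P Q where PQ: "poly Q z \<noteq> 0" "fps_of_poly Q * Abs_fps a = fps_of_poly P"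
      "s = poly P z / poly Q z"
    using assms unfolding has_rational_sum_def by blast
  have "Abs_fps (\<lambda>m. c * a m) = fps_const c * Abs_fps a"
    by (simp add: fps_eq_iff)
  then have "fps_of_poly Q * Abs_fps (\<lambda>m. c * a m) = fps_of_poly (smult c P)"
    by (simp add: fps_of_poly_smult PQ(2)[symmetric] mult_ac)
  then show ?thesis
    unfolding has_rational_sum_def using PQ
    by (intro exI[of _ "smult c P"] exI[of _ Q]) simp
qed

text \<open>The shift multiplies the generating function by its variable.\<close>

lemma has_rational_sum_shift:
  assumes "has_rational_sum a z s"
  shows "has_rational_sum (\<lambda>m. if m = 0 then 0 else a (m - 1)) z (z * s)"
proof -
  obtain P Q where PQ: "poly Q z \<noteq> 0" "fps_of_poly Q * Abs_fps a = fps_of_poly P"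
      "s = poly P z / poly Q z"
    using assms unfolding has_rational_sum_def by blast
  have "Abs_fps (\<lambda>m. if m = 0 then 0 else a (m - 1)) = fps_X * Abs_fps a"
    by (simp add: fps_eq_iff)
  then have "fps_of_poly Q * Abs_fps (\<lambda>m. if m = 0 then 0 else a (m - 1)) = fps_of_poly (pCons 0 P)"
    by (simp add: fps_of_poly_pCons PQ(2)[symmetric] mult_ac)
  then show ?thesis
    unfolding has_rational_sum_def using PQ
    by (intro exI[of _ "pCons 0 P"] exI[of _ Q]) simp
qed

text \<open>For \<open>r = 0\<close> truncated subtraction makes \<open>(m + r - 1) choose m\<close> the indicator of \<open>m = 0\<close>,
  which is the right value.\<close>

definition neg_binomial_seq :: "nat \<Rightarrow> (nat \<Rightarrow> 'a::field) \<Rightarrow> nat \<Rightarrow> 'a" where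
  "neg_binomial_seq r f m = of_nat ((m + r - 1) choose m) * (- 1) ^ m * f m"

lemma neg_binomial_seq_0: "neg_binomial_seq 0 f = (\<lambda>m. if m = 0 then f 0 else 0)"
  by (auto simp: neg_binomial_seq_def fun_eq_iff binomial_eq_0)

lemma has_rational_sum_neg_binomial_0: "has_rational_sum (neg_binomial_seq 0 f) z (f 0)"
proof -
  have "Abs_fps (neg_binomial_seq 0 f) = fps_of_poly [:f 0:]"
    by (simp add: fps_eq_iff neg_binomial_seq_0 coeff_pCons split: nat.splits)
  then show ?thesis
    unfolding has_rational_sum_def
    by (intro exI[of _ "[:f 0:]"] exI[of _ 1]) simp
qed

text \<open>Absorption: at \<open>m = Suc k\<close> the product of the two binomial coefficients is
  \<open>r / Suc j\<close> times the one for \<open>Suc r\<close>, \<open>j\<close> and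
  \<open>k\<close>. Lowering \<open>j\<close> thus costs a shift and one more in
  \<open>r\<close>.\<close>

lemma neg_binomial_seq_binomial_Suc:
  fixes c :: "'a::field_char_0"
  shows "neg_binomial_seq r (\<lambda>m. c ^ m * of_nat (m choose Suc j)) m =
    - of_nat r * c / of_nat (Suc j) *
      (if m = 0 then 0 else neg_binomial_seq (Suc r) (\<lambda>m. c ^ m * of_nat (m choose j)) (m - 1))"
proof (cases m)
  case (Suc k)
  have 1: "Suc j * (Suc k choose Suc j) = Suc k * (k choose j)"
    by (rule Suc_times_binomial)
  have 2: "Suc k * ((k + r) choose Suc k) = r * ((k + r) choose k)"
  proof (cases r)
    case (Suc r')
    then show ?thesis
      using binomial_absorb_comp[of "k + r" k] Suc_times_binomial[of k "k + r'"] by simp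
  qed simp
  have "of_nat (Suc j) * of_nat ((k + r) choose Suc k) * of_nat (Suc k choose Suc j)
      = of_nat r * of_nat ((k + r) choose k) * (of_nat (k choose j) :: 'a)"
    unfolding of_nat_mult[symmetric] of_nat_eq_iff
    using 1 2 by (metis (no_types, lifting) mult.assoc mult.commute)
  then show ?thesis
    unfolding neg_binomial_seq_def Suc
    by (simp add: divide_simps del: of_nat_Suc binomial_Suc_Suc)
      (simp add: algebra_simps del: of_nat_Suc binomial_Suc_Suc)
qed (simp add: neg_binomial_seq_def)

lemma has_rational_sum_exp_binomial:
  fixes c z :: "'a::field_char_0"
  assumes "1 + c * z \<noteq> 0"
  shows "\<exists>s. has_rational_sum (neg_binomial_seq r (\<lambda>m. c ^ m * of_nat (m choose j))) z s"
\<comment> \<open>The step for \<open>Suc j\<close> at \<open>r\<close> uses the hypothesis at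
  \<open>Suc r\<close>; for \<open>j = 0\<close> and \<open>r > 0\<close> this is the negative
  binomial series.\<close>
proof (induction j arbitrary: r)
  case 0
  show ?case
  proof (cases "r = 0")
    case True
    then show ?thesis using has_rational_sum_neg_binomial_0 by blast
  next
    case False
    moreover have "neg_binomial_seq r (\<lambda>m. c ^ m * of_nat (m choose 0)) =
        (\<lambda>m. of_nat ((m + r - 1) choose m) * (- c) ^ m)"
      by (simp add: neg_binomial_seq_def fun_eq_iff power_minus[of c] mult_ac)
    ultimately show ?thesis using has_rational_sum_binomial[OF _ assms, of r] by auto
  qed
next
  case (Suc j)
  then obtain s where
    s: "has_rational_sum (neg_binomial_seq (Suc r) (\<lambda>m. c ^ m * of_nat (m choose j))) z s"
    by blast
  show ?case
    using has_rational_sum_cmult[OF has_rational_sum_shift[OF s],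
        of "- of_nat r * c / of_nat (Suc j)"]
    unfolding neg_binomial_seq_binomial_Suc[symmetric] by blast
qed

text \<open>The operator \<open>P\<close> of the overview: times \<open>w ^ m\<close>, it is the sum
  of two consecutive values of \<open>w ^ m * h m\<close>.\<close>

definition twisted_sum :: "'a::field \<Rightarrow> (nat \<Rightarrow> 'a) \<Rightarrow> nat \<Rightarrow> 'a" where
  "twisted_sum w h m = h m + w * h (Suc m)"

text \<open>Pascal's rule splits the coefficient of \<open>f m\<close>; its second part is the
  shifted sequence, with a sign change from the power of \<open>- 1\<close>.\<close>

lemma neg_binomial_seq_Suc:
  "neg_binomial_seq (Suc r) (twisted_sum w f) m =
     neg_binomial_seq r f m
     + (w * neg_binomial_seq (Suc r) (\<lambda>m. f (Suc m)) m
        - (if m = 0 then 0 else neg_binomial_seq (Suc r) (\<lambda>m. f (Suc m)) (m - 1)))"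
  by (cases m) (simp_all add: neg_binomial_seq_def twisted_sum_def algebra_simps)

text \<open>At the point \<open>w\<close> itself, multiplication by the variable and by the scalar \<open>w\<close> agree, so the
  two shifted terms of the previous identity cancel.\<close>

lemma has_rational_sum_twisted_sum:
  assumes "has_rational_sum (neg_binomial_seq r f) w s"
    and "has_rational_sum (neg_binomial_seq (Suc r) (\<lambda>m. f (Suc m))) w t"
  shows "has_rational_sum (neg_binomial_seq (Suc r) (twisted_sum w f)) w s"
proof -
  have "has_rational_sum (neg_binomial_seq (Suc r) (twisted_sum w f)) w
      (s + (w * t + (- 1) * (w * t)))"
    using has_rational_sum_add[OF assms(1) has_rational_sum_add[OF
          has_rational_sum_cmult[OF assms(2), of w]
          has_rational_sum_cmult[OF has_rational_sum_shift[OF assms(2)], of "- 1"]]]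
    by (simp add: neg_binomial_seq_Suc[abs_def])
  then show ?thesis by simp
qed

section \<open>The ultrametric absolute value\<close>

context padic_complex
begin

lemma vabs_0_iff [simp]: "vabs x = 0 \<longleftrightarrow> x = 0"
  using dist_vabs[of x 0] by (metis diff_zero dist_eq_0_iff)

lemma vabs_0 [simp]: "vabs 0 = 0"
  by simp

lemma vabs_nonneg [simp]: "0 \<le> vabs x"
  using dist_vabs[of x 0] by (metis diff_zero zero_le_dist)

lemma vabs_1 [simp]: "vabs 1 = 1"
  using vabs_mult[of 1 1] by simp

lemma vabs_minus [simp]: "vabs (- x) = vabs x"
  by (metis dist_commute dist_vabs diff_0 diff_zero)

lemma vabs_minus_commute: "vabs (x - y) = vabs (y - x)"
  by (metis minus_diff_eq vabs_minus)

lemma vabs_diff_ultra: "vabs (x - y) \<le> max (vabs x) (vabs y)"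
  using vabs_ultra[of x "- y"] by simp

lemma vabs_triangle: "vabs (x + y) \<le> vabs x + vabs y"
  using vabs_ultra[of x y] vabs_nonneg[of x] vabs_nonneg[of y] by linarith

lemma vabs_power: "vabs (x ^ n) = vabs x ^ n"
  by (induction n) (simp_all add: vabs_mult)

lemma vabs_divide: "vabs (x / y) = vabs x / vabs y"
proof (cases "y = 0")
  case False
  then have "vabs (x / y) * vabs y = vabs x"
    by (simp flip: vabs_mult)
  with False show ?thesis by (simp add: field_simps)
qed simp

lemma vabs_sum_le:
  assumes "\<And>i. i \<in> A \<Longrightarrow> vabs (f i) \<le> B" and "0 \<le> B"
  shows "vabs (sum f A) \<le> B"
  using assms(1)
proof (induction A rule: infinite_finite_induct)
  case (insert a A)
  then show ?case using vabs_ultra[of "f a" "sum f A"] by fastforce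
qed (use assms(2) in auto)

lemma vabs_of_nat_le_1: "vabs (of_nat n) \<le> 1"
  using vabs_sum_le[of "{..<n}" "\<lambda>_. 1" 1] by simp

lemma vabs_of_int_le_1: "vabs (of_int k) \<le> 1"
  by (cases k rule: int_cases2) (simp_all add: vabs_of_nat_le_1)

lemma p_gt_1: "1 < p"
  using prime_p prime_gt_1_nat by blast

text \<open>In a Bezout relation \<open>u * k + v * p = 1\<close> the second term has absolute value
  below 1, so the ultrametric inequality forces the first to have at least 1.\<close>

lemma vabs_of_int_coprime:
  assumes "coprime k (int p)"
  shows "vabs (of_int k) = 1"
proof -
  obtain u v where "u * k + v * int p = 1"
    using assms by (metis bezout_int coprime_imp_gcd_eq_1)
  then have "of_int (u * k) + of_int v * of_nat p = (1 :: 'c)"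
    by (metis of_int_1 of_int_add of_int_mult of_int_of_nat_eq)
  then have "1 \<le> max (vabs (of_int (u * k))) (vabs (of_int v * of_nat p))"
    by (metis vabs_1 vabs_ultra)
  moreover have "vabs (of_int v * of_nat p) < 1"
  proof -
    have "vabs (of_int v * of_nat p) \<le> 1 * (1 / real p)"
      unfolding vabs_mult vabs_p using vabs_of_int_le_1 by (intro mult_right_mono) auto
    also have "\<dots> < 1" using p_gt_1 by simp
    finally show ?thesis .
  qed
  ultimately have "1 \<le> vabs (of_int u) * vabs (of_int k)"
    by (simp add: vabs_mult)
  also have "\<dots> \<le> 1 * vabs (of_int k)"
    by (intro mult_right_mono vabs_of_int_le_1) simp
  finally show ?thesis using vabs_of_int_le_1[of k] by simp
qed

text \<open>Outside the powers of \<open>p\<close>, a factor of \<open>d\<close> has absolute value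
  1, so \<open>vabs\<close> reads off the multiplicity of \<open>p\<close>.\<close>

lemma vabs_of_nat_le_imp_dvd:
  assumes "vabs (of_nat d) \<le> (1 / real p) ^ N"
  shows "p ^ N dvd d"
proof (cases "d = 0")
  case False
  obtain e where e: "d = p ^ multiplicity p d * e" "\<not> p dvd e"
    using multiplicity_decompose'[of d p] False prime_p by (metis not_prime_unit)
  have "coprime (int e) (int p)"
    using e(2) prime_p by (metis coprime_commute coprime_int_iff prime_imp_coprime)
  then have "vabs (of_nat e) = 1"
    using vabs_of_int_coprime[of "int e"] by simp
  then have "vabs (of_nat d) = (1 / real p) ^ multiplicity p d"
    by (subst e(1)) (simp add: vabs_mult vabs_power vabs_p)
  then have "N \<le> multiplicity p d"
    using assms p_gt_1 by (simp add: power_decreasing_iff)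
  then show ?thesis by (rule multiplicity_dvd')
qed simp

section \<open>Limits and the continuity of the ring operations\<close>

lemma LIMSEQ_vabs_iff: "f \<longlonglongrightarrow> l \<longleftrightarrow> (\<lambda>n. vabs (f n - l)) \<longlonglongrightarrow> 0"
  using tendsto_dist_iff[of f l sequentially] by (simp add: dist_vabs)

lemma LIMSEQ_vabs_bound:
  assumes "\<And>n. vabs (f n - l) \<le> b n" and "b \<longlonglongrightarrow> 0"
  shows "f \<longlonglongrightarrow> l"
  unfolding LIMSEQ_vabs_iff
  by (rule tendsto_sandwich[OF _ _ tendsto_const assms(2)]) (simp_all add: assms(1))

text \<open>The sort of \<open>'c\<close> does not link field and metric; continuity of addition
  comes from \<open>vabs\<close>.\<close>

lemma LIMSEQ_add:
  fixes f g :: "nat \<Rightarrow> 'c"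
  assumes "f \<longlonglongrightarrow> l" and "g \<longlonglongrightarrow> k"
  shows "(\<lambda>n. f n + g n) \<longlonglongrightarrow> l + k"
proof -
  have "(\<lambda>n. vabs (f n - l) + vabs (g n - k)) \<longlonglongrightarrow> 0"
    using tendsto_add[OF assms[unfolded LIMSEQ_vabs_iff]] by simp
  moreover have "vabs (f n + g n - (l + k)) \<le> vabs (f n - l) + vabs (g n - k)" for n
    using vabs_triangle[of "f n - l" "g n - k"] by (simp add: algebra_simps)
  ultimately show ?thesis by (intro LIMSEQ_vabs_bound) auto
qed

lemma LIMSEQ_mult:
  fixes f g :: "nat \<Rightarrow> 'c"
  assumes "f \<longlonglongrightarrow> l" and "g \<longlonglongrightarrow> k"
  shows "(\<lambda>n. f n * g n) \<longlonglongrightarrow> l * k"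
proof -
  let ?B = "\<lambda>n. vabs (f n - l) * vabs (g n - k) + (vabs (f n - l) * vabs k + vabs l * vabs (g n - k))"
  have "?B \<longlonglongrightarrow> 0 * 0 + (0 * vabs k + vabs l * 0)"
    using assms unfolding LIMSEQ_vabs_iff by (intro tendsto_intros)
  moreover have "vabs (f n * g n - l * k) \<le> ?B n" for n
  proof -
    have "f n * g n - l * k = (f n - l) * (g n - k) + ((f n - l) * k + l * (g n - k))"
      by (simp add: algebra_simps)
    then show ?thesis
      using vabs_triangle[of "(f n - l) * (g n - k)" "(f n - l) * k + l * (g n - k)"]
        vabs_triangle[of "(f n - l) * k" "l * (g n - k)"] by (simp add: vabs_mult)
  qed
  ultimately show ?thesis by (intro LIMSEQ_vabs_bound) auto
qed

section \<open>Powers of elements close to 1\<close>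

lemma vabs_eq_1_if_near_1:
  assumes "vabs (1 - c) < 1"
  shows "vabs c = 1"
  using vabs_diff_ultra[of 1 "1 - c"] vabs_ultra[of c "1 - c"] assms by simp

lemma near_1_mult:
  assumes "vabs (1 - c) < 1" and "vabs (1 - d) < 1"
  shows "vabs (1 - c * d) < 1"
proof -
  have "1 - c * d = (1 - c) + c * (1 - d)" by (simp add: algebra_simps)
  moreover have "vabs (c * (1 - d)) < 1"
    using assms(2) vabs_eq_1_if_near_1[OF assms(1)] by (simp add: vabs_mult)
  ultimately show ?thesis
    using vabs_ultra[of "1 - c" "c * (1 - d)"] assms(1) by (metis max_less_iff_conj order_le_less_trans)
qed

text \<open>The distance from 1 to -1 is the absolute value of 2, which is 1 for odd
  \<open>p\<close>.\<close>

lemma near_1_imp_ne_minus_1: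
  assumes "odd p" and "vabs (1 - c) < 1"
  shows "1 + c \<noteq> 0"
proof
  assume "1 + c = 0"
  then have "c = - 1" by (simp add: add_eq_0_iff)
  then have "1 - c = of_int 2" by simp
  moreover have "vabs (of_int 2) = 1"
    using assms(1) by (intro vabs_of_int_coprime) simp
  ultimately show False using assms(2) by (metis less_irrefl)
qed

text \<open>\<open>c - 1\<close> divides \<open>c ^ n - 1\<close>, and the cofactor, a geometric
  sum, has absolute value at most 1.\<close>

lemma vabs_power_diff_1_le:
  assumes "vabs (1 - c) \<le> B" and "B \<le> 1"
  shows "vabs (c ^ n - 1) \<le> B"
proof -
  have "vabs c \<le> 1" using vabs_diff_ultra[of 1 "1 - c"] assms by simp
  then have "vabs (\<Sum>i<n. c ^ i) \<le> 1"
    by (intro vabs_sum_le) (simp_all add: vabs_power power_le_one)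
  then have "vabs (c - 1) * vabs (\<Sum>i<n. c ^ i) \<le> vabs (c - 1) * 1"
    by (intro mult_left_mono) simp_all
  moreover have "vabs (c ^ n - 1) = vabs (c - 1) * vabs (\<Sum>i<n. c ^ i)"
    by (simp add: power_diff_1_eq flip: vabs_mult)
  ultimately show ?thesis using assms(1) by (simp add: vabs_minus_commute)
qed

text \<open>Here the cofactor is \<open>p\<close> plus the sum of the \<open>c ^ i - 1\<close>, so
  it is small as well: raising to the power \<open>p\<close> contracts towards 1.\<close>

lemma vabs_power_p_diff_1_le:
  assumes "vabs (c - 1) \<le> B" and "B \<le> 1"
  shows "vabs (c ^ p - 1) \<le> max (1 / real p) B * vabs (c - 1)"
proof -
  have B0: "0 \<le> B" using assms(1) vabs_nonneg order_trans by blast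
  have "(\<Sum>i<p. c ^ i) = of_nat p + (\<Sum>i<p. c ^ i - 1)"
    by (simp add: sum_subtractf)
  moreover have "vabs (\<Sum>i<p. c ^ i - 1) \<le> B"
    using assms B0 by (intro vabs_sum_le vabs_power_diff_1_le) (simp_all add: vabs_minus_commute)
  ultimately have "vabs (\<Sum>i<p. c ^ i) \<le> max (1 / real p) B"
    using vabs_ultra[of "of_nat p" "\<Sum>i<p. c ^ i - 1"] by (auto simp: vabs_p le_max_iff_disj)
  then show ?thesis
    by (simp add: power_diff_1_eq vabs_mult mult.commute mult_left_mono)
qed

lemma LIMSEQ_power_prime_power:
  assumes "vabs (1 - c) < 1"
  shows "(\<lambda>N. c ^ p ^ N) \<longlonglongrightarrow> 1"
proof -
  \<comment> \<open>No power of \<open>c\<close> is farther from 1 than \<open>c\<close> itself, so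
    this one factor bounds every contraction.\<close>
  define \<rho> where "\<rho> = max (1 / real p) (vabs (1 - c))"
  have \<rho>: "0 \<le> \<rho>" "\<rho> < 1" using assms p_gt_1 by (auto simp: \<rho>_def le_max_iff_disj)
  have "vabs (c ^ p ^ N - 1) \<le> \<rho> ^ N" for N
  proof (induction N)
    case 0
    then show ?case using assms by (simp add: vabs_minus_commute)
  next
    case (Suc N)
    have "vabs (c ^ p ^ N - 1) \<le> vabs (1 - c)"
      using assms by (intro vabs_power_diff_1_le) auto
    then have "vabs ((c ^ p ^ N) ^ p - 1) \<le> \<rho> * vabs (c ^ p ^ N - 1)"
      unfolding \<rho>_def using assms by (intro vabs_power_p_diff_1_le) auto
    also have "\<dots> \<le> \<rho> * \<rho> ^ N" using Suc \<rho> by (intro mult_left_mono)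
    finally show ?case by (simp add: power_mult[symmetric] mult.commute)
  qed
  moreover have "(\<lambda>N. \<rho> ^ N) \<longlonglongrightarrow> 0"
    using \<rho> by (intro LIMSEQ_power_zero) simp
  ultimately show ?thesis by (intro LIMSEQ_vabs_bound) auto
qed

lemma LIMSEQ_prime_power: "(\<lambda>N. of_nat (p ^ N) :: 'c) \<longlonglongrightarrow> 0"
proof -
  have "(\<lambda>N. (1 / real p) ^ N) \<longlonglongrightarrow> 0"
    using p_gt_1 by (intro LIMSEQ_power_zero) simp
  then show ?thesis
    unfolding LIMSEQ_vabs_iff by (simp add: vabs_power vabs_p)
qed

text \<open>Close exponents are congruent modulo a high power \<open>p ^ N\<close>, and
  \<open>c ^ p ^ N\<close> is near 1.\<close>

lemma power_uniformly_continuous: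
  assumes "vabs (1 - c) < 1" and "0 < e"
  obtains d where "0 < d" and "\<And>n m. vabs (of_nat n - of_nat m) < d \<Longrightarrow> vabs (c ^ n - c ^ m) < e"
proof -
  \<comment> \<open>The bound 1 is what \<open>vabs_power_diff_1_le\<close> asks of
    \<open>c ^ p ^ N\<close>.\<close>
  obtain N where N: "vabs (c ^ p ^ N - 1) < min e 1"
    using LIMSEQ_power_prime_power[OF assms(1)] assms(2)
    unfolding lim_sequentially dist_vabs by (metis min_less_iff_conj order_refl zero_less_one)
  have *: "vabs (c ^ n - c ^ m) < e"
    if nm: "vabs (of_nat n - of_nat m) < (1 / real p) ^ N" and le: "m \<le> n" for n m
  proof -
    have "p ^ N dvd n - m"
      using nm le by (intro vabs_of_nat_le_imp_dvd) (simp add: of_nat_diff)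
    then obtain k where k: "n = m + p ^ N * k"
      using le by (metis dvdE le_add_diff_inverse)
    have "vabs ((c ^ p ^ N) ^ k - 1) \<le> vabs (c ^ p ^ N - 1)"
      by (rule vabs_power_diff_1_le) (use N in \<open>simp_all add: vabs_minus_commute[of 1 "c ^ p ^ N"]\<close>)
    moreover have "c ^ n - c ^ m = c ^ m * ((c ^ p ^ N) ^ k - 1)"
      by (simp add: k power_add power_mult right_diff_distrib)
    ultimately show ?thesis
      using N vabs_eq_1_if_near_1[OF assms(1)] by (simp add: vabs_mult vabs_power)
  qed
  show ?thesis
  proof (rule that[of "(1 / real p) ^ N"])
    show "0 < (1 / real p) ^ N" using p_gt_1 by simp
    show "vabs (c ^ n - c ^ m) < e" if "vabs (of_nat n - of_nat m) < (1 / real p) ^ N" for n m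
      using *[of n m] *[of m n] that by (metis linear vabs_minus_commute)
  qed
qed

section \<open>The p-adic power function\<close>

text \<open>Uniform continuity makes the powers along \<open>u\<close> Cauchy; their limit is then
  shown to be the limit along the whole filter defining \<open>padic_pow\<close>.\<close>

lemma padic_pow_LIMSEQ:
  assumes c: "vabs (1 - c) < 1" and u: "(\<lambda>k. of_nat (u k)) \<longlonglongrightarrow> x"
  shows "(\<lambda>k. c ^ u k) \<longlonglongrightarrow> padic_pow c x"
proof -
  have "Cauchy (\<lambda>k. c ^ u k)"
    unfolding Cauchy_def
  proof (intro allI impI)
    fix e :: real assume "0 < e"
    then obtain d where d: "0 < d"
      "\<And>n m. vabs (of_nat n - of_nat m) < d \<Longrightarrow> vabs (c ^ n - c ^ m) < e"
      using power_uniformly_continuous[OF c] by blast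
    have "Cauchy (\<lambda>k. of_nat (u k) :: 'c)" using u by (rule LIMSEQ_imp_Cauchy)
    then show "\<exists>M. \<forall>m\<ge>M. \<forall>n\<ge>M. dist (c ^ u m) (c ^ u n) < e"
      using d unfolding Cauchy_def dist_vabs by blast
  qed
  then obtain L where L: "(\<lambda>k. c ^ u k) \<longlonglongrightarrow> L"
    using Cauchy_convergent convergent_def by blast
  let ?F = "filtercomap of_nat (nhds x) :: nat filter"
  have "((\<lambda>n. c ^ n) \<longlongrightarrow> L) ?F"
  proof (rule tendstoI)
    fix e :: real assume e: "0 < e"
    then obtain d where d: "0 < d"
      "\<And>n m. vabs (of_nat n - of_nat m) < d \<Longrightarrow> vabs (c ^ n - c ^ m) < e"
      using power_uniformly_continuous[OF c] by blast
    have "eventually (\<lambda>k. dist (of_nat (u k)) x < d \<and> dist (c ^ u k) L < e) sequentially"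
      using tendstoD[OF u d(1)] tendstoD[OF L e] by (rule eventually_conj)
    then obtain k where k: "vabs (of_nat (u k) - x) < d" "vabs (c ^ u k - L) < e"
      unfolding dist_vabs eventually_sequentially by blast
    \<comment> \<open>The term \<open>u k\<close> links the two: its exponent is near
      \<open>n\<close> and its power near \<open>L\<close>.\<close>
    have "vabs (c ^ n - L) < e" if n: "vabs (of_nat n - x) < d" for n
    proof -
      have "vabs (of_nat n - of_nat (u k)) < d"
        using vabs_diff_ultra[of "of_nat n - x" "of_nat (u k) - x"] k(1) n by simp
      then show ?thesis
        using vabs_ultra[of "c ^ n - c ^ u k" "c ^ u k - L"] d(2) k(2) by fastforce
    qed
    moreover have "eventually (\<lambda>n. dist (of_nat n) x < d) ?F"
      using d(1) by (intro eventually_filtercomapI) (auto simp: eventually_nhds_metric)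
    ultimately show "eventually (\<lambda>n. dist (c ^ n) L < e) ?F"
      unfolding dist_vabs by (rule eventually_mono[rotated])
  qed
  \<comment> \<open>Limits are unique only along a proper filter; \<open>u\<close> shows that
    naturals reach every neighbourhood of \<open>x\<close>.\<close>
  moreover have "?F \<noteq> bot"
  proof (rule filtercomap_neq_bot)
    fix P assume "eventually P (nhds x)"
    then have "eventually (\<lambda>k. P (of_nat (u k))) sequentially"
      using u by (simp add: filterlim_iff)
    then show "\<exists>n. P (of_nat n)" by (auto simp: eventually_sequentially)
  qed
  ultimately have "padic_pow c x = L"
    unfolding padic_pow_def by (intro tendsto_Lim)
  with L show ?thesis by simp
qed

lemma padic_pow_of_nat:
  assumes "vabs (1 - c) < 1"
  shows "padic_pow c (of_nat n) = c ^ n"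
  by (rule LIMSEQ_unique[OF padic_pow_LIMSEQ[OF assms tendsto_const] tendsto_const])

section \<open>Density of the natural numbers in the p-adic integers\<close>

text \<open>The denominator of \<open>a\<close> in lowest terms is prime to \<open>p\<close>, hence
  invertible modulo \<open>p ^ N\<close>; \<open>n\<close> is the residue of the fraction.\<close>

lemma padic_rat_near_nat:
  assumes "a \<in> \<rat>" and "vabs a \<le> 1" and "0 < e"
  shows "\<exists>n. vabs (of_nat n - a) < e"
proof -
  obtain k l where kl: "0 < l" "coprime k l" "a = of_int k / of_int l"
    using assms(1) by (metis Rats_cases')
  have l: "coprime l (int p)"
  \<comment> \<open>If \<open>p\<close> divided \<open>l\<close>, it would not divide
    \<open>k\<close>, so \<open>k\<close> would have absolute value 1, whereas \<open>a * l\<close>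
    has at most \<open>1 / p\<close>.\<close>
  proof (rule ccontr)
    assume "\<not> coprime l (int p)"
    then have pl: "int p dvd l"
      using prime_p by (metis coprime_commute prime_imp_coprime prime_nat_int_transfer)
    then obtain l' where l': "l = int p * l'" by blast
    have "coprime k (int p)" using kl(2) pl by (meson coprime_divisors dvd_refl)
    then have "vabs (of_int k) = 1" by (rule vabs_of_int_coprime)
    then have "1 = vabs a * vabs (of_int l)"
      using kl by (simp add: vabs_divide)
    also have "\<dots> \<le> 1 * (1 / real p * 1)"
      unfolding l' using assms(2) vabs_of_int_le_1
      by (intro mult_mono) (simp_all add: vabs_mult vabs_p divide_right_mono)
    finally show False using p_gt_1 by simp
  qed
  obtain N where N: "(1 / real p) ^ N < e"
    using real_arch_pow_inv[of e "1 / real p"] assms(3) p_gt_1 by auto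
  have "coprime l (int p ^ N)" using l by simp
  then obtain b where b: "[l * b = 1] (mod int p ^ N)"
    using cong_solve_coprime_int by blast
  define n where "n = nat ((b * k) mod int p ^ N)"
  have n: "int n = (b * k) mod int p ^ N"
    unfolding n_def using p_gt_1 by simp
  then have "[l * int n = l * (b * k)] (mod int p ^ N)"
    by (simp add: cong_def mod_mult_right_eq)
  also have "[l * (b * k) = 1 * k] (mod int p ^ N)"
    using cong_mult[OF b cong_refl[of k]] by (simp add: mult_ac)
  finally obtain t where t: "l * int n - k = int p ^ N * t"
    by (auto simp: cong_iff_dvd_diff)
  \<comment> \<open>Clearing the denominator is free because \<open>l\<close> has absolute value
    1.\<close>
  have "vabs (of_nat n - a) = vabs (of_int l * (of_nat n - a))"
    by (simp add: vabs_mult vabs_of_int_coprime[OF l])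
  also have "of_int l * (of_nat n - a) = of_int (l * int n - k)"
    using kl by (simp add: algebra_simps)
  also have "vabs \<dots> \<le> (1 / real p) ^ N * 1"
    unfolding t of_int_mult vabs_mult
    using vabs_of_int_le_1[of t] by (intro mult_mono) (simp_all add: vabs_power vabs_p)
  finally have "vabs (of_nat n - a) < e" using N by simp
  then show ?thesis ..
qed

lemma padic_int_LIMSEQ_nat:
  assumes "x \<in> padic_ints vabs"
  obtains u :: "nat \<Rightarrow> nat" where "(\<lambda>k. of_nat (u k)) \<longlonglongrightarrow> x"
proof -
  have "x \<in> closure (range (of_nat :: nat \<Rightarrow> 'c))"
    unfolding closure_approachable
  proof (intro allI impI)
    fix e :: real assume e: "0 < e"
    have "x \<in> closure \<rat>" using assms by (simp add: padic_ints_def padic_rats_def)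
    \<comment> \<open>Closeness within 1 makes the rational \<open>a\<close> integral too, by the
      ultrametric inequality.\<close>
    then obtain a where a: "a \<in> \<rat>" "vabs (a - x) < min e 1"
      using e unfolding closure_approachable dist_vabs by (metis min_less_iff_conj zero_less_one)
    have "vabs a \<le> 1"
      using vabs_ultra[of "a - x" x] a(2) assms by (auto simp: padic_ints_def max_def split: if_splits)
    then obtain n where "vabs (of_nat n - a) < e"
      using padic_rat_near_nat a(1) e by blast
    then have "vabs (of_nat n - x) < e"
      using vabs_ultra[of "of_nat n - a" "a - x"] a(2) by auto
    then show "\<exists>y\<in>range of_nat. dist y x < e" by (auto simp: dist_vabs)
  qed
  then obtain v where v: "\<And>k. v k \<in> range (of_nat :: nat \<Rightarrow> 'c)" "v \<longlonglongrightarrow> x"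
    unfolding closure_sequential by blast
  have "\<forall>k. \<exists>n. v k = of_nat n" using v(1) by blast
  then obtain u where "\<forall>k. v k = of_nat (u k)" by (auto dest!: choice)
  then have "v = (\<lambda>k. of_nat (u k))" by blast
  with v(2) that show ?thesis by blast
qed

text \<open>Both sides are limits of \<open>c ^ (u k + m)\<close> for naturals \<open>u k\<close>
  tending to \<open>x\<close>.\<close>

lemma padic_pow_add_of_nat:
  assumes c: "vabs (1 - c) < 1" and "x \<in> padic_ints vabs"
  shows "padic_pow c (x + of_nat m) = padic_pow c x * c ^ m"
proof -
  obtain u :: "nat \<Rightarrow> nat" where u: "(\<lambda>k. of_nat (u k)) \<longlonglongrightarrow> x"
    using padic_int_LIMSEQ_nat[OF assms(2)] .
  have "(\<lambda>k. of_nat (u k + m)) \<longlonglongrightarrow> x + of_nat m"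
    using LIMSEQ_add[OF u tendsto_const] by simp
  then have "(\<lambda>k. c ^ (u k + m)) \<longlonglongrightarrow> padic_pow c (x + of_nat m)"
    by (rule padic_pow_LIMSEQ[OF c])
  moreover have "(\<lambda>k. c ^ (u k + m)) \<longlonglongrightarrow> padic_pow c x * c ^ m"
    unfolding power_add by (intro LIMSEQ_mult padic_pow_LIMSEQ[OF c u] tendsto_const)
  ultimately show ?thesis by (rule LIMSEQ_unique)
qed

section \<open>Exponential polynomials\<close>

text \<open>Binomial coefficients replace powers of \<open>m\<close> because shifts act on them by
  Pascal's rule. With \<open>a\<close> built into the basis, closure under scalars is
  derivable.\<close>

inductive exp_poly :: "(nat \<Rightarrow> 'c) \<Rightarrow> bool" where
  basis: "vabs (1 - c) < 1 \<Longrightarrow> exp_poly (\<lambda>m. a * (c ^ m * of_nat (m choose j)))"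
| add: "exp_poly f \<Longrightarrow> exp_poly g \<Longrightarrow> exp_poly (\<lambda>m. f m + g m)"

lemma exp_poly_const: "exp_poly (\<lambda>_. a)"
  using basis[of 1 a 0] by simp

lemma exp_poly_cmult:
  assumes "exp_poly f"
  shows "exp_poly (\<lambda>m. b * f m)"
  using assms
proof induction
  case (basis c a j)
  then show ?case using exp_poly.basis[of c "b * a" j] by (simp add: mult_ac)
next
  case (add f g)
  then show ?case using exp_poly.add by (simp add: distrib_left)
qed

lemma exp_poly_power_mult:
  assumes "exp_poly f" and "vabs (1 - d) < 1"
  shows "exp_poly (\<lambda>m. d ^ m * f m)"
  using assms(1)
proof induction
  case (basis c a j)
  then show ?case
    using exp_poly.basis[OF near_1_mult[OF assms(2)], of c a j]
    by (simp add: power_mult_distrib mult_ac)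
next
  case (add f g)
  then show ?case using exp_poly.add by (simp add: distrib_left)
qed

text \<open>Multiplying \<open>m choose j\<close> by \<open>m\<close> gives a combination of the
  coefficients for \<open>Suc j\<close> and \<open>j\<close>. This serves the case
  \<open>q = 1\<close>.\<close>

lemma exp_poly_of_nat_mult:
  assumes "exp_poly f"
  shows "exp_poly (\<lambda>m. of_nat m * f m)"
  using assms
proof induction
  case (basis c a j)
  have "of_nat m * of_nat (m choose j) =
      of_nat (Suc j) * of_nat (m choose Suc j) + of_nat j * (of_nat (m choose j) :: 'c)" for m
  proof -
    have "m * (m choose j) = Suc j * (m choose Suc j) + j * (m choose j)"
    proof (cases "j \<le> m")
      case True
      then have "m * (m choose j) = (m - j) * (m choose j) + j * (m choose j)"
        by (simp flip: distrib_right)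
      also have "(m - j) * (m choose j) = Suc j * (m choose Suc j)"
        by (simp only: binomial_absorb_comp binomial_absorption)
      finally show ?thesis .
    qed (simp add: binomial_eq_0)
    then show ?thesis by (metis of_nat_add of_nat_mult)
  qed
  then have "(\<lambda>m. of_nat m * (a * (c ^ m * of_nat (m choose j)))) =
      (\<lambda>m. (a * of_nat (Suc j)) * (c ^ m * of_nat (m choose Suc j))
          + (a * of_nat j) * (c ^ m * of_nat (m choose j)))"
    by (intro ext) (simp only: mult.left_commute[of "of_nat _"] distrib_left mult.assoc)
  then show ?case using basis exp_poly.basis exp_poly.add by (simp only:)
next
  case (add f g)
  then show ?case using exp_poly.add by (simp add: distrib_left)
qed

lemma exp_poly_shift:
  assumes "exp_poly f"
  shows "exp_poly (\<lambda>m. f (Suc m))"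
  using assms
proof induction
  case (basis c a j)
  show ?case
  proof (cases j)
    case 0
    then show ?thesis using exp_poly.basis[OF basis, of "a * c" 0] by (simp add: mult_ac)
  next
    case (Suc i)
    then show ?thesis
      using exp_poly.add[OF exp_poly.basis[OF basis, of "a * c" i]
          exp_poly.basis[OF basis, of "a * c" "Suc i"]] by (simp add: algebra_simps)
  qed
next
  case (add f g)
  then show ?case using exp_poly.add by simp
qed

text \<open>For fixed \<open>c\<close> the operator is triangular in \<open>j\<close>, with diagonal
  entry \<open>1 + w * c\<close>, which is nonzero; so it is inverted recursively.\<close>

lemma exp_poly_twisted_sum_surj:
  assumes "odd p" and w: "vabs (1 - w) < 1" and "exp_poly f"
  shows "\<exists>h. exp_poly h \<and> twisted_sum w h = f"
  using assms(3)
proof induction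
  case (basis c a j)
  have nz: "1 + w * c \<noteq> 0"
    by (intro near_1_imp_ne_minus_1 near_1_mult assms basis)
  have "\<exists>h. exp_poly h \<and> twisted_sum w h = (\<lambda>m. a * (c ^ m * of_nat (m choose j)))" for a
  proof (induction j arbitrary: a)
    case 0
    show ?case
    proof (intro exI conjI ext)
      show "exp_poly (\<lambda>m. a / (1 + w * c) * (c ^ m * of_nat (m choose 0)))"
        by (rule exp_poly.basis[OF basis])
      have "b * c ^ m + w * (b * (c * c ^ m)) = b * (1 + w * c) * c ^ m" for b m
        by (simp add: algebra_simps)
      then show "twisted_sum w (\<lambda>m. a / (1 + w * c) * (c ^ m * of_nat (m choose 0))) m =
          a * (c ^ m * of_nat (m choose 0))" for m
        using nz by (simp add: twisted_sum_def del: times_divide_eq_left) simp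
    qed
  next
    case (Suc j)
    let ?b = "a / (1 + w * c)"
    \<comment> \<open>This \<open>h\<close> cancels the term in \<open>m choose j\<close> that
      Pascal's rule produces from the leading term.\<close>
    obtain h where h: "exp_poly h"
      "twisted_sum w h = (\<lambda>m. (- (?b * w * c)) * (c ^ m * of_nat (m choose j)))"
      using Suc by blast
    let ?h = "\<lambda>m. ?b * (c ^ m * of_nat (m choose Suc j)) + h m"
    have "exp_poly ?h" using exp_poly.basis[OF basis] h(1) by (rule exp_poly.add)
    moreover have "twisted_sum w ?h m = a * (c ^ m * of_nat (m choose Suc j))" for m
    proof -
      have "twisted_sum w ?h m = ?b * (1 + w * c) * (c ^ m * of_nat (m choose Suc j))
          + ?b * w * c * (c ^ m * of_nat (m choose j)) + twisted_sum w h m"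
        unfolding twisted_sum_def binomial_Suc_Suc of_nat_add power_Suc
        by (simp only: algebra_simps mult_1_left)
      then show ?thesis using nz by (simp add: h(2))
    qed
    ultimately show ?case by blast
  qed
  then show ?case .
next
  case (add f g)
  then obtain h k where "exp_poly h" "twisted_sum w h = f" "exp_poly k" "twisted_sum w k = g"
    by blast
  moreover from this have "twisted_sum w (\<lambda>m. h m + k m) = (\<lambda>m. f m + g m)"
    by (auto simp: twisted_sum_def algebra_simps)
  ultimately show ?case using exp_poly.add by blast
qed

lemma exp_poly_twisted_sum:
  assumes "exp_poly f"
  shows "exp_poly (twisted_sum w f)"
  unfolding twisted_sum_def by (intro exp_poly.add exp_poly_cmult exp_poly_shift assms)

lemma exp_poly_twisted_sum_iter:
  assumes "exp_poly f"
  shows "exp_poly ((twisted_sum w ^^ r) f)"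
  by (induction r) (simp_all add: assms exp_poly_twisted_sum)

lemma exp_poly_twisted_sum_iter_surj:
  assumes "odd p" and "vabs (1 - w) < 1" and "exp_poly f"
  shows "\<exists>h. exp_poly h \<and> (twisted_sum w ^^ r) h = f"
proof (induction r)
  case 0
  show ?case using assms(3) by simp
next
  case (Suc r)
  then show ?case
    using exp_poly_twisted_sum_surj[OF assms(1,2)]
    by (metis comp_apply funpow_Suc_right)
qed

text \<open>For a basis function the only possible pole is at \<open>- 1 / c\<close>, and
  \<open>1 + c * w\<close> is nonzero.\<close>

lemma exp_poly_has_rational_sum:
  assumes "odd p" and "vabs (1 - w) < 1" and "exp_poly f"
  shows "\<exists>s. has_rational_sum (neg_binomial_seq r f) w s"
  using assms(3)
proof induction
  case (basis c a j)
  have "1 + c * w \<noteq> 0"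
    by (intro near_1_imp_ne_minus_1 near_1_mult assms basis)
  then obtain s where
    "has_rational_sum (neg_binomial_seq r (\<lambda>m. c ^ m * of_nat (m choose j))) w s"
    using has_rational_sum_exp_binomial by blast
  from has_rational_sum_cmult[OF this, of a] show ?case
    by (auto simp: neg_binomial_seq_def mult_ac)
next
  case (add f g)
  then obtain s t where "has_rational_sum (neg_binomial_seq r f) w s"
    "has_rational_sum (neg_binomial_seq r g) w t" by blast
  from has_rational_sum_add[OF this] show ?case
    by (auto simp: neg_binomial_seq_def algebra_simps)
qed

text \<open>Raising \<open>r\<close> and applying the operator once more leaves the sum unchanged,
  and at \<open>r = 0\<close> only \<open>h 0\<close> remains. The auxiliary sum \<open>t\<close>
  need only exist, since it cancels.\<close>

lemma has_rational_sum_twisted_sum_iter: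
  assumes "odd p" and "vabs (1 - w) < 1" and "exp_poly h"
  shows "has_rational_sum (neg_binomial_seq r ((twisted_sum w ^^ r) h)) w (h 0)"
proof (induction r)
  case 0
  show ?case using has_rational_sum_neg_binomial_0 by simp
next
  case (Suc r)
  obtain t where
    "has_rational_sum (neg_binomial_seq (Suc r) (\<lambda>m. (twisted_sum w ^^ r) h (Suc m))) w t"
    using exp_poly_has_rational_sum[OF assms(1,2)
        exp_poly_shift[OF exp_poly_twisted_sum_iter[OF assms(3)]]] by blast
  with Suc show ?case by (auto intro: has_rational_sum_twisted_sum)
qed

text \<open>Along \<open>s + p ^ N\<close> the powers converge because \<open>c ^ p ^ N\<close>
  tends to 1, the binomial coefficients because they are polynomials in the upper index.\<close>

lemma exp_poly_LIMSEQ: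
  assumes "exp_poly f"
  shows "(\<lambda>N. f (s + p ^ N)) \<longlonglongrightarrow> f s"
  using assms
proof induction
  case (basis c a j)
  have c: "(\<lambda>N. c ^ (s + p ^ N)) \<longlonglongrightarrow> c ^ s"
    unfolding power_add
    using LIMSEQ_mult[OF tendsto_const LIMSEQ_power_prime_power[OF basis]] by simp
  have "(\<lambda>N. of_nat ((s + p ^ N) choose j)) \<longlonglongrightarrow> (of_nat (s choose j) :: 'c)"
  proof (induction j)
    case 0
    show ?case by simp
  next
    case (Suc j)
    \<comment> \<open>This recursion builds the binomial coefficient from sums and products, whose
      limits are known.\<close>
    have step: "of_nat (m choose Suc j) =
        of_nat (m choose j) * ((of_nat m + - of_nat j) * (1 / of_nat (Suc j)) :: 'c)" for m
      using gbinomial_mult_1[of "of_nat m :: 'c" j]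
      by (simp add: binomial_gbinomial field_simps del: of_nat_Suc)
    have "(\<lambda>N. of_nat (s + p ^ N)) \<longlonglongrightarrow> (of_nat s :: 'c)"
      using LIMSEQ_add[OF tendsto_const LIMSEQ_prime_power, of "of_nat s"] by simp
    then show ?case
      unfolding step by (intro LIMSEQ_mult Suc LIMSEQ_add tendsto_const)
  qed
  then show ?case by (intro LIMSEQ_mult c tendsto_const)
next
  case (add f g)
  then show ?case by (intro LIMSEQ_add)
qed

section \<open>Fermionic integrals\<close>

text \<open>Each term pairs neighbouring values of \<open>w ^ m * h m\<close>, so the sum telescopes
  to its two ends.\<close>

lemma alternating_twisted_sum:
  fixes h :: "nat \<Rightarrow> 'c"
  shows "(\<Sum>x<n. w ^ (s + x) * twisted_sum w h (s + x) * (- 1) ^ x) =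
    w ^ s * h s + - ((- 1) ^ n) * (w ^ (s + n) * h (s + n))"
  by (induction n) (simp_all add: twisted_sum_def algebra_simps)

text \<open>Each integration removes one application of the operator and yields a factor 2. Only
  values of \<open>F\<close> at naturals enter; \<open>s\<close> is general because the inner
  integrals start at \<open>s + x\<close>.\<close>

lemma fermionic_integral_iter_twisted_sum:
  assumes "odd p" and w: "vabs (1 - w) < 1" and "exp_poly h"
    and "\<And>m. F (of_nat m) = w ^ m * (twisted_sum w ^^ r) h m"
  shows "fermionic_integral_iter p r (\<lambda>xs. F (of_nat s + sum_list xs)) = 2 ^ r * (w ^ s * h s)"
  using assms(3,4)
proof (induction r arbitrary: h s)
  case 0
  then show ?case by simp
next
  case (Suc r)
  have IH: "fermionic_integral_iter p r (\<lambda>xs. F (of_nat k + sum_list xs)) =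
      2 ^ r * (w ^ k * twisted_sum w h k)" for k
    \<comment> \<open>The hypothesis is applied to \<open>twisted_sum w h\<close>: the innermost
      application is split off by \<open>funpow_swap1\<close>.\<close>
    using Suc.prems by (intro Suc.IH exp_poly_twisted_sum) (simp_all add: funpow_swap1)
  have "(\<Sum>x<p ^ N. fermionic_integral_iter p r
          (\<lambda>ys. F (of_nat s + sum_list (of_nat x # ys))) * (- 1) ^ x) =
      2 ^ r * (w ^ s * h s + w ^ (s + p ^ N) * h (s + p ^ N))" for N
  proof -
    have "of_nat s + sum_list (of_nat x # ys) = of_nat (s + x) + sum_list ys" for x and ys :: "'c list"
      by (simp add: add.assoc)
    then have "(\<Sum>x<p ^ N. fermionic_integral_iter p r
          (\<lambda>ys. F (of_nat s + sum_list (of_nat x # ys))) * (- 1) ^ x) =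
        2 ^ r * (\<Sum>x<p ^ N. w ^ (s + x) * twisted_sum w h (s + x) * (- 1) ^ x)"
      by (simp only: IH sum_distrib_left mult.assoc)
    \<comment> \<open>As \<open>p ^ N\<close> is odd, the end terms add up instead of
      cancelling.\<close>
    also have "\<dots> = 2 ^ r * (w ^ s * h s + w ^ (s + p ^ N) * h (s + p ^ N))"
      using assms(1) by (simp add: alternating_twisted_sum)
    finally show ?thesis .
  qed
  moreover have "(\<lambda>N. 2 ^ r * (w ^ s * h s + w ^ (s + p ^ N) * h (s + p ^ N)))
      \<longlonglongrightarrow> 2 ^ r * (w ^ s * h s + w ^ s * h s)"
    using exp_poly_LIMSEQ[OF exp_poly_power_mult[OF Suc.prems(1) w]]
    by (intro LIMSEQ_mult[OF tendsto_const] LIMSEQ_add[OF tendsto_const])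
  ultimately show ?case
    by (simp add: fermionic_integral_def limI algebra_simps)
qed

text \<open>For \<open>q = 1\<close> the q-number is \<open>x + m\<close>; otherwise it is a
  constant plus a multiple of \<open>q ^ m\<close>. Multiplication by either stays in the
  class.\<close>

lemma exp_poly_qnum_power:
  assumes "vabs (1 - q) < 1" and "x \<in> padic_ints vabs"
  shows "exp_poly (\<lambda>m. qnum q (x + of_nat m) ^ n)"
proof (induction n)
  case 0
  show ?case using exp_poly_const[of 1] by simp
next
  case (Suc n)
  let ?f = "\<lambda>m. qnum q (x + of_nat m) ^ n"
  show ?case
  proof (cases "q = 1")
    case True
    then show ?thesis
      using exp_poly.add[OF exp_poly_cmult[OF Suc, of x] exp_poly_of_nat_mult[OF Suc]]
      by (simp add: qnum_def algebra_simps)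
  next
    case False
    define a where "a = 1 / (1 - q)"
    have "qnum q (x + of_nat m) = a + (- a * padic_pow q x) * q ^ m" for m
      using False by (simp add: qnum_def a_def padic_pow_add_of_nat[OF assms] diff_divide_distrib)
    then have "(\<lambda>m. qnum q (x + of_nat m) ^ Suc n) =
        (\<lambda>m. a * ?f m + (- a * padic_pow q x) * (q ^ m * ?f m))"
      by (simp only: power_Suc distrib_right mult.assoc)
    then show ?thesis
      using exp_poly.add[OF exp_poly_cmult[OF Suc]
          exp_poly_cmult[OF exp_poly_power_mult[OF Suc assms(1)]]] by (simp only:)
  qed
qed

end

section \<open>Genocchi numbers and comparison with the integral\<close>

text \<open>The factor \<open>fps_X ^ r\<close> moves the coefficient of index \<open>n\<close>,
  which is \<open>s / fact n\<close>, to index \<open>n + r\<close>; the denominator turns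
  \<open>fact (n + r)\<close> into \<open>fact n\<close>.\<close>

lemma q_genocchi_add_eq:
  assumes "has_rational_sum (neg_binomial_seq r (\<lambda>m. qnum q (x + of_nat m) ^ n)) w s"
  shows "q_genocchi r w q x (n + r) / (fact r * of_nat ((n + r) choose r)) = 2 ^ r * s"
proof -
  have "rational_sum (\<lambda>m. fps_nth (fps_const (of_nat ((m + r - 1) choose m) * (-1) ^ m)
      * fps_exp (qnum q (of_nat m + x))) n) w = 1 / fact n * s"
    using has_rational_sum_cmult[OF assms, of "1 / fact n"]
    by (intro rational_sum_eqI) (simp add: neg_binomial_seq_def add.commute)
  then have "q_genocchi r w q x (n + r) = fact (n + r) * (2 ^ r * (s / fact n))"
    by (simp add: q_genocchi_def q_genocchi_gf_def rational_fps_sum_def mult.assoc fps_X_power_mult_nth)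
  moreover have "fact (n + r) = fact n * (fact r * of_nat ((n + r) choose r) :: 'a)"
    using binomial_fact'[of r "n + r"] binomial_fact_lemma[of r "n + r"]
    by (metis (no_types, lifting) add_diff_cancel_right' le_add2 mult.commute mult.left_commute of_nat_fact of_nat_mult)
  moreover have "of_nat ((n + r) choose r) \<noteq> (0 :: 'a)" by simp
  ultimately show ?thesis by (simp add: field_simps)
qed

theorem theorem5:
  fixes p r n :: nat
    and vabs :: "'c::{field_char_0, complete_space} \<Rightarrow> real"
    and q w x :: 'c
  assumes "padic_complex p vabs" and "odd p"
    and "vabs (1 - q) < 1" and "vabs (1 - w) < 1"
    and "r \<ge> 1" and "x \<in> padic_ints vabs"
  shows "q_genocchi r w q x (n + r) / (fact r * of_nat ((n + r) choose r)) =
           fermionic_integral_iter p r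
             (\<lambda>xs. padic_pow w (sum_list xs) * qnum q (x + sum_list xs) ^ n)
       \<and> fermionic_integral_iter p r
             (\<lambda>xs. padic_pow w (sum_list xs) * qnum q (x + sum_list xs) ^ n) =
           q_euler p r w q x n
       \<and> (\<forall>k<r. q_genocchi r w q x k = 0)"
proof -
  interpret padic_complex p vabs by fact
  let ?f = "\<lambda>m. qnum q (x + of_nat m) ^ n"
  \<comment> \<open>This \<open>h\<close> evaluates both sides: each equals
    \<open>2 ^ r * h 0\<close>.\<close>
  obtain h where h: "exp_poly h" "(twisted_sum w ^^ r) h = ?f"
    using exp_poly_twisted_sum_iter_surj[OF \<open>odd p\<close> \<open>vabs (1 - w) < 1\<close>
        exp_poly_qnum_power[OF \<open>vabs (1 - q) < 1\<close> \<open>x \<in> padic_ints vabs\<close>]] by blast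
  have "fermionic_integral_iter p r
      (\<lambda>xs. padic_pow w (sum_list xs) * qnum q (x + sum_list xs) ^ n) = 2 ^ r * h 0"
    using fermionic_integral_iter_twisted_sum[OF \<open>odd p\<close> \<open>vabs (1 - w) < 1\<close> h(1),
        of "\<lambda>y. padic_pow w y * qnum q (x + y) ^ n" r 0]
    by (simp add: h(2) padic_pow_of_nat[OF \<open>vabs (1 - w) < 1\<close>])
  moreover have "has_rational_sum (neg_binomial_seq r ?f) w (h 0)"
    using has_rational_sum_twisted_sum_iter[OF \<open>odd p\<close> \<open>vabs (1 - w) < 1\<close> h(1), of r]
    by (simp only: h(2))
  \<comment> \<open>The factor \<open>fps_X ^ r\<close> leaves no coefficient below index
    \<open>r\<close>.\<close>
  moreover have "q_genocchi r w q x k = 0" if "k < r" for k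
    using that
    by (simp add: q_genocchi_def q_genocchi_gf_def mult.assoc fps_X_power_mult_nth)
  ultimately show ?thesis
    by (simp add: q_genocchi_add_eq q_euler_def)
qed

end
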